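(* Let $\epsilon>0$ and let $x^1,\dots,x^{T+1}$ be the (accepted) iterates generated by Algorithm Adap-RPPM (described in the context) from the starting point $x^0\in\operatorname{dom} f$ and initial parameter $\lambda_0>0$, such that $$d(x^{k+1},x^k)>\epsilon,\qquad k=0,\dots,T.$$ Then $$T<\frac{4\,(f(x^0)-f^{\mathrm{low}})}{\lambda_0\,\epsilon^2}.$$
   Context: Setting. $\mathcal{M}$ is a finite-dimensional Hadamard manifold (complete, simply connected Riemannian manifold with nonpositive sectional curvature), with Riemannian metric $\langle\cdot,\cdot\rangle$, norm $\|\cdot\|$, Riemannian distance $d$, exponential map $\exp_x:T_x\mathcal{M}\to\mathcal{M}$ with inverse $\exp_x^{-1}$, and Riemannian gradient $\operatorname{grad}$. The functions are: $g_1:\mathcal{M}\to\mathbb{R}\cup\{+\infty\}$ proper and lower semicontinuous; $g_2:\mathcal{M}\to\mathbb{R}$ continuously differentiable with gradient Lipschitz continuous on $\mathcal{M}$ with constant $L>0$, i.e. $\|\operatorname{grad} g_2(x)-\Gamma_{x,y}\operatorname{grad} g_2(y)\|\le L\,d(x,y)$ for all $x,y$, where $\Gamma_{x,y}:T_y\mathcal{M}\to T_x\mathcal{M}$ is parallel transport along the geodesic joining $y$ to $x$; $h:\mathcal{M}\to\mathbb{R}$ (geodesically) convex, with $\partial h(x)=\{u\in T_x\mathcal{M}:\langle u,\exp_x^{-1}y\rangle\le h(y)-h(x)\ \forall y\in\mathcal{M}\}$. Put $f:=g_1+g_2-h$ and $\operatorname{dom} f=\{x: f(x)<+\infty\}$.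 Standing assumptions. (i) For each fixed $y\in\mathcal{M}$ there is $\gamma\in\mathbb{R}$ with $\liminf_{d(x,y)\to+\infty} g_1(x)/d(x,y)>\gamma$. (ii) $f^{\mathrm{low}}\in\mathbb{R}$ is a constant with $f(x)\ge f^{\mathrm{low}}$ for all $x\in\mathcal{M}$. Algorithm Adap-RPPM. Step 0: input $x^0\in\operatorname{dom} f$, $\lambda_0>0$, $\epsilon>0$; set $k=0$. Step 1: given $x^k\in\operatorname{dom} f$, set $v^k=\operatorname{grad} g_2(x^k)$ and choose $w^k\in\partial h(x^k)$. Step 1.2: set $z^k=\exp_{x^k}\big(\tfrac1{\lambda_k}(w^k-v^k)\big)$. Step 2: choose $x^{k+1}\in\arg\min_{x\in\mathcal{M}}\{g_1(x)+\tfrac{\lambda_k}{2}d^2(x,z^k)\}$. Step 3: if $d(x^{k+1},x^k)\le\epsilon$, stop. Otherwise go to Step 4. Step 4: if $f(x^{k+1})-f(x^k)\le-\tfrac{\lambda_k}{4}d^2(x^{k+1},x^k)$, then accept $x^{k+1}$, set $\lambda_{k+1}\leftarrow\lambda_k$, $k\leftarrow k+1$ and go to Step 1; otherwise replace $\lambda_k\leftarrow 2\lambda_k$ and go to Step 1.2 (recomputing $z^k$ and $x^{k+1}$). In the claim, $\lambda_0$ denotes the initial value supplied in Step 0 (before any doubling), and the iterates $x^{k+1}$ are those accepted in Step 4. *)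

theory Defs
  imports "HOL-Analysis.Analysis"
begin

section \<open>Smooth manifolds\<close>

text \<open>Functions of class \<open>C\<^sup>k\<close> on an open subset \<open>S\<close> of a Euclidean space.\<close>

primrec Ck_on :: "nat \<Rightarrow> 'e::euclidean_space set \<Rightarrow> ('e \<Rightarrow> 'f::real_normed_vector) \<Rightarrow> bool" where
  "Ck_on 0 S f \<longleftrightarrow> continuous_on S f"
| "Ck_on (Suc n) S f \<longleftrightarrow>
     (\<forall>p\<in>S. f differentiable (at p)) \<and>
     (\<forall>i\<in>Basis. Ck_on n S (\<lambda>p. frechet_derivative f (at p) i))"

text \<open>A chart is a pair of its domain and its coordinate map; values of the coordinate map outside
  the domain are irrelevant.\<close>

type_synonym ('a, 'e) chart = "'a set \<times> ('a \<Rightarrow> 'e)"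

text \<open>
  The underlying space of the manifold is the whole type \<open>'a\<close>, and the model space is the Euclidean
  space \<open>'e\<close>, of dimension \<open>DIM('e)\<close>. Every point \<open>x\<close> comes with a preferred chart
  \<open>chart_at M x\<close> around it, and the tangent space at \<open>x\<close> is identified with \<open>'e\<close> through the
  coordinates of that chart. The inner product \<open>metric M x\<close> is expressed in these coordinates.
  Nothing is assumed about how the preferred chart varies with \<open>x\<close>; smoothness conditions are
  always formulated after a change to a fixed chart.
\<close>

record ('a, 'e) riemannian_structure =
  atlas :: "('a, 'e) chart set"
  chart_at :: "'a \<Rightarrow> ('a, 'e) chart"
  metric :: "'a \<Rightarrow> 'e \<Rightarrow> 'e \<Rightarrow> real"

definition chart_inv :: "('a, 'e) chart \<Rightarrow> 'e \<Rightarrow> 'a" where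
  "chart_inv \<alpha> = inv_into (fst \<alpha>) (snd \<alpha>)"

definition is_chart :: "('a::topological_space, 'e::euclidean_space) chart \<Rightarrow> bool" where
  "is_chart \<alpha> \<longleftrightarrow> open (fst \<alpha>) \<and> open (snd \<alpha> ` fst \<alpha>) \<and>
     homeomorphism (fst \<alpha>) (snd \<alpha> ` fst \<alpha>) (snd \<alpha>) (chart_inv \<alpha>)"

definition smooth_manifold ::
    "('a::{t2_space,second_countable_topology}, 'e::euclidean_space) riemannian_structure \<Rightarrow> bool" where
  "smooth_manifold M \<longleftrightarrow>
     (\<forall>\<alpha>\<in>atlas M. is_chart \<alpha>) \<and>
     (\<forall>x. chart_at M x \<in> atlas M \<and> x \<in> fst (chart_at M x)) \<and>
     (\<forall>\<alpha>\<in>atlas M. \<forall>\<beta>\<in>atlas M. \<forall>k.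
        Ck_on k (snd \<alpha> ` (fst \<alpha> \<inter> fst \<beta>)) (snd \<beta> \<circ> chart_inv \<alpha>))"

text \<open>\<open>change_coords \<alpha> \<beta> x v\<close>: the coordinates with respect to \<open>\<beta>\<close> of the tangent vector at \<open>x\<close>
  whose coordinates with respect to \<open>\<alpha>\<close> are \<open>v\<close>.\<close>

definition change_coords ::
    "('a, 'e::euclidean_space) chart \<Rightarrow> ('a, 'e) chart \<Rightarrow> 'a \<Rightarrow> 'e \<Rightarrow> 'e" where
  "change_coords \<alpha> \<beta> x v = frechet_derivative (snd \<beta> \<circ> chart_inv \<alpha>) (at (snd \<alpha> x)) v"

definition to_chart ::
    "('a, 'e::euclidean_space) riemannian_structure \<Rightarrow> ('a, 'e) chart \<Rightarrow> 'a \<Rightarrow> 'e \<Rightarrow> 'e" where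
  "to_chart M \<alpha> x = change_coords (chart_at M x) \<alpha> x"

definition from_chart ::
    "('a, 'e::euclidean_space) riemannian_structure \<Rightarrow> ('a, 'e) chart \<Rightarrow> 'a \<Rightarrow> 'e \<Rightarrow> 'e" where
  "from_chart M \<alpha> x = change_coords \<alpha> (chart_at M x) x"


section \<open>Riemannian metric, connection and curvature\<close>

definition local_metric ::
    "('a, 'e::euclidean_space) riemannian_structure \<Rightarrow> ('a, 'e) chart \<Rightarrow> 'e \<Rightarrow> 'e \<Rightarrow> 'e \<Rightarrow> real" where
  "local_metric M \<alpha> p u v =
     (let x = chart_inv \<alpha> p in metric M x (from_chart M \<alpha> x u) (from_chart M \<alpha> x v))"

definition riemannian_manifold ::
    "('a::{t2_space,second_countable_topology}, 'e::euclidean_space) riemannian_structure \<Rightarrow> bool" where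
  "riemannian_manifold M \<longleftrightarrow>
     smooth_manifold M \<and>
     (\<forall>x. bilinear (metric M x) \<and> (\<forall>u v. metric M x u v = metric M x v u) \<and>
          (\<forall>u. u \<noteq> 0 \<longrightarrow> metric M x u u > 0)) \<and>
     (\<forall>\<alpha>\<in>atlas M. \<forall>u v k. Ck_on k (snd \<alpha> ` fst \<alpha>) (\<lambda>p. local_metric M \<alpha> p u v))"

definition tnorm :: "('a, 'e) riemannian_structure \<Rightarrow> 'a \<Rightarrow> 'e \<Rightarrow> real" where
  "tnorm M x u = sqrt (metric M x u u)"

text \<open>The Christoffel symbols of the Levi-Civita connection in the chart \<open>\<alpha>\<close>, that is
  \<open>\<Sum>\<^sub>i\<^sub>j \<Gamma>\<^sup>k\<^sub>i\<^sub>j u\<^sup>i v\<^sup>j\<close>, given by the Koszul formula for constant coordinate fields.\<close>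

definition christoffel ::
    "('a, 'e::euclidean_space) riemannian_structure \<Rightarrow> ('a, 'e) chart \<Rightarrow> 'e \<Rightarrow> 'e \<Rightarrow> 'e \<Rightarrow> 'e" where
  "christoffel M \<alpha> p u v = (THE c. \<forall>w. local_metric M \<alpha> p c w =
     (frechet_derivative (\<lambda>q. local_metric M \<alpha> q v w) (at p) u
      + frechet_derivative (\<lambda>q. local_metric M \<alpha> q u w) (at p) v
      - frechet_derivative (\<lambda>q. local_metric M \<alpha> q u v) (at p) w) / 2)"

text \<open>The curvature tensor with the convention
  \<open>R(X,Y)Z = \<nabla>\<^sub>X\<nabla>\<^sub>Y Z - \<nabla>\<^sub>Y\<nabla>\<^sub>X Z - \<nabla>\<^bsub>[X,Y]\<^esub> Z\<close>, in the coordinates of \<open>\<alpha>\<close>.\<close>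

definition curvature ::
    "('a, 'e::euclidean_space) riemannian_structure \<Rightarrow> ('a, 'e) chart \<Rightarrow> 'e \<Rightarrow> 'e \<Rightarrow> 'e \<Rightarrow> 'e \<Rightarrow> 'e" where
  "curvature M \<alpha> p u v w =
     frechet_derivative (\<lambda>q. christoffel M \<alpha> q v w) (at p) u
     - frechet_derivative (\<lambda>q. christoffel M \<alpha> q u w) (at p) v
     + christoffel M \<alpha> p u (christoffel M \<alpha> p v w)
     - christoffel M \<alpha> p v (christoffel M \<alpha> p u w)"

definition sectional_curvature ::
    "('a, 'e::euclidean_space) riemannian_structure \<Rightarrow> 'a \<Rightarrow> 'e \<Rightarrow> 'e \<Rightarrow> real" where
  "sectional_curvature M x u v =
     metric M x (curvature M (chart_at M x) (snd (chart_at M x) x) u v v) u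
     / (metric M x u u * metric M x v v - (metric M x u v)\<^sup>2)"


section \<open>Curves, geodesics and distance\<close>

definition velocity ::
    "('a, 'e::euclidean_space) riemannian_structure \<Rightarrow> (real \<Rightarrow> 'a) \<Rightarrow> real \<Rightarrow> 'e" where
  "velocity M c t = vector_derivative (snd (chart_at M (c t)) \<circ> c) (at t)"

text \<open>\<open>V t\<close> is a tangent vector at \<open>c t\<close>; the condition says that the covariant derivative of \<open>V\<close>
  along \<open>c\<close> vanishes.\<close>

definition parallel_along ::
    "('a, 'e::euclidean_space) riemannian_structure \<Rightarrow> (real \<Rightarrow> 'a) \<Rightarrow> (real \<Rightarrow> 'e) \<Rightarrow> bool" where
  "parallel_along M c V \<longleftrightarrow>
     (\<forall>\<alpha>\<in>atlas M. \<forall>t. c t \<in> fst \<alpha> \<longrightarrow>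
        ((\<lambda>s. to_chart M \<alpha> (c s) (V s)) has_vector_derivative
          - christoffel M \<alpha> (snd \<alpha> (c t)) (to_chart M \<alpha> (c t) (velocity M c t))
              (to_chart M \<alpha> (c t) (V t))) (at t))"

definition geodesic ::
    "('a::topological_space, 'e::euclidean_space) riemannian_structure \<Rightarrow> (real \<Rightarrow> 'a) \<Rightarrow> bool" where
  "geodesic M c \<longleftrightarrow>
     continuous_on UNIV c \<and>
     (\<forall>\<alpha>\<in>atlas M. \<forall>t. c t \<in> fst \<alpha> \<longrightarrow> (snd \<alpha> \<circ> c) differentiable (at t)) \<and>
     parallel_along M c (velocity M c)"

definition C1_curve_on ::
    "('a::topological_space, 'e::euclidean_space) riemannian_structure \<Rightarrow> real \<Rightarrow> real \<Rightarrow> (real \<Rightarrow> 'a) \<Rightarrow> bool" where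
  "C1_curve_on M a b c \<longleftrightarrow>
     continuous_on {a..b} c \<and>
     (\<forall>\<alpha>\<in>atlas M. \<forall>t\<in>{a..b}. c t \<in> fst \<alpha> \<longrightarrow>
        (snd \<alpha> \<circ> c) differentiable (at t within {a..b}) \<and>
        continuous (at t within {a..b})
          (\<lambda>s. vector_derivative (snd \<alpha> \<circ> c) (at s within {a..b})))"

text \<open>Piecewise \<open>C\<^sup>1\<close> up to and including the break points, so that the speed is bounded.\<close>

definition piecewise_C1_curve ::
    "('a::topological_space, 'e::euclidean_space) riemannian_structure \<Rightarrow> (real \<Rightarrow> 'a) \<Rightarrow> bool" where
  "piecewise_C1_curve M c \<longleftrightarrow>
     (\<exists>ts. ts \<noteq> [] \<and> sorted_wrt (<) ts \<and> hd ts = 0 \<and> last ts = 1 \<and>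
        (\<forall>i. Suc i < length ts \<longrightarrow> C1_curve_on M (ts ! i) (ts ! Suc i) c))"

definition curve_length ::
    "('a, 'e::euclidean_space) riemannian_structure \<Rightarrow> (real \<Rightarrow> 'a) \<Rightarrow> real" where
  "curve_length M c = integral {0..1} (\<lambda>t. tnorm M (c t) (velocity M c t))"

definition rdist ::
    "('a::topological_space, 'e::euclidean_space) riemannian_structure \<Rightarrow> 'a \<Rightarrow> 'a \<Rightarrow> real" where
  "rdist M x y = Inf {curve_length M c | c. piecewise_C1_curve M c \<and> c 0 = x \<and> c 1 = y}"


section \<open>Hadamard manifolds\<close>

definition geodesically_complete ::
    "('a::topological_space, 'e::euclidean_space) riemannian_structure \<Rightarrow> bool" where
  "geodesically_complete M \<longleftrightarrow> (\<forall>x v. \<exists>c. geodesic M c \<and> c 0 = x \<and> velocity M c 0 = v)"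

definition hadamard_manifold ::
    "('a::{t2_space,second_countable_topology}, 'e::euclidean_space) riemannian_structure \<Rightarrow> bool" where
  "hadamard_manifold M \<longleftrightarrow>
     riemannian_manifold M \<and>
     geodesically_complete M \<and>
     simply_connected (UNIV :: 'a set) \<and>
     (\<forall>x u v. u \<noteq> v \<and> independent {u, v} \<longrightarrow> sectional_curvature M x u v \<le> 0)"

definition rexp ::
    "('a::topological_space, 'e::euclidean_space) riemannian_structure \<Rightarrow> 'a \<Rightarrow> 'e \<Rightarrow> 'a" where
  "rexp M x v = (THE y. \<exists>c. geodesic M c \<and> c 0 = x \<and> velocity M c 0 = v \<and> c 1 = y)"

definition rexp_inv ::
    "('a::topological_space, 'e::euclidean_space) riemannian_structure \<Rightarrow> 'a \<Rightarrow> 'a \<Rightarrow> 'e" where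
  "rexp_inv M x = inv (rexp M x)"

text \<open>\<open>ptransport M x y\<close> maps the tangent space at \<open>y\<close> to the one at \<open>x\<close>.\<close>

definition ptransport ::
    "('a::topological_space, 'e::euclidean_space) riemannian_structure \<Rightarrow> 'a \<Rightarrow> 'a \<Rightarrow> 'e \<Rightarrow> 'e" where
  "ptransport M x y u =
     (THE w. \<exists>c V. geodesic M c \<and> c 0 = y \<and> c 1 = x \<and> parallel_along M c V \<and> V 0 = u \<and> V 1 = w)"


section \<open>Functions on the manifold\<close>

definition C1_function ::
    "('a, 'e::euclidean_space) riemannian_structure \<Rightarrow> ('a \<Rightarrow> real) \<Rightarrow> bool" where
  "C1_function M g \<longleftrightarrow> (\<forall>\<alpha>\<in>atlas M. Ck_on 1 (snd \<alpha> ` fst \<alpha>) (g \<circ> chart_inv \<alpha>))"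

definition rgrad ::
    "('a, 'e::euclidean_space) riemannian_structure \<Rightarrow> ('a \<Rightarrow> real) \<Rightarrow> 'a \<Rightarrow> 'e" where
  "rgrad M g x = (THE u. \<forall>v. metric M x u v =
     frechet_derivative (g \<circ> chart_inv (chart_at M x)) (at (snd (chart_at M x) x)) v)"

definition lipschitz_gradient ::
    "('a::topological_space, 'e::euclidean_space) riemannian_structure \<Rightarrow> real \<Rightarrow> ('a \<Rightarrow> real) \<Rightarrow> bool" where
  "lipschitz_gradient M L g \<longleftrightarrow>
     (\<forall>x y. tnorm M x (rgrad M g x - ptransport M x y (rgrad M g y)) \<le> L * rdist M x y)"

definition geodesically_convex ::
    "('a::topological_space, 'e::euclidean_space) riemannian_structure \<Rightarrow> ('a \<Rightarrow> real) \<Rightarrow> bool" where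
  "geodesically_convex M h \<longleftrightarrow> (\<forall>c. geodesic M c \<longrightarrow> convex_on UNIV (h \<circ> c))"

definition subdifferential ::
    "('a::topological_space, 'e::euclidean_space) riemannian_structure \<Rightarrow> ('a \<Rightarrow> real) \<Rightarrow> 'a \<Rightarrow> 'e set" where
  "subdifferential M h x = {u. \<forall>y. metric M x u (rexp_inv M x y) \<le> h y - h x}"

definition proper_function :: "('a \<Rightarrow> ereal) \<Rightarrow> bool" where
  "proper_function g \<longleftrightarrow> (\<forall>x. g x \<noteq> -\<infinity>) \<and> (\<exists>x. g x < \<infinity>)"

definition lower_semicontinuous :: "('a::topological_space \<Rightarrow> ereal) \<Rightarrow> bool" where
  "lower_semicontinuous g \<longleftrightarrow> (\<forall>x. g x \<le> Liminf (at x) g)"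

definition effective_domain :: "('a \<Rightarrow> ereal) \<Rightarrow> 'a set" where
  "effective_domain f = {x. f x < \<infinity>}"

definition objective :: "('a \<Rightarrow> ereal) \<Rightarrow> ('a \<Rightarrow> real) \<Rightarrow> ('a \<Rightarrow> real) \<Rightarrow> 'a \<Rightarrow> ereal" where
  "objective g1 g2 h x = g1 x + ereal (g2 x) - ereal (h x)"


section \<open>Algorithm Adap-RPPM\<close>

definition proximal_candidate ::
    "('a::topological_space, 'e::euclidean_space) riemannian_structure \<Rightarrow> ('a \<Rightarrow> ereal) \<Rightarrow> ('a \<Rightarrow> real) \<Rightarrow>
     'a \<Rightarrow> 'e \<Rightarrow> real \<Rightarrow> 'a \<Rightarrow> bool" where
  "proximal_candidate M g1 g2 x w lam x' \<longleftrightarrow>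
     (let v = rgrad M g2 x; z = rexp M x ((1 / lam) *\<^sub>R (w - v))
      in is_arg_min (\<lambda>y. g1 y + ereal (lam / 2 * (rdist M y z)\<^sup>2)) (\<lambda>_. True) x')"

definition sufficient_decrease ::
    "('a::topological_space, 'e::euclidean_space) riemannian_structure \<Rightarrow> ('a \<Rightarrow> ereal) \<Rightarrow> 'a \<Rightarrow> real \<Rightarrow> 'a \<Rightarrow> bool" where
  "sufficient_decrease M f x lam x' \<longleftrightarrow> f x' - f x \<le> ereal (- (lam / 4) * (rdist M x' x)\<^sup>2)"

text \<open>\<open>adap_rppm_search M g1 g2 h \<epsilon> x w lam lam' x'\<close>: starting with parameter \<open>lam\<close> at the iterate
  \<open>x\<close> with the chosen subgradient \<open>w\<close>, the algorithm accepts \<open>x'\<close> with parameter \<open>lam'\<close> after finitely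
  many doublings. The stopping test comes before the decrease test, hence each candidate, accepted
  or not, has to be at distance greater than \<open>\<epsilon>\<close> from \<open>x\<close> for the run to continue.\<close>

inductive adap_rppm_search ::
    "('a::topological_space, 'e::euclidean_space) riemannian_structure \<Rightarrow> ('a \<Rightarrow> ereal) \<Rightarrow> ('a \<Rightarrow> real) \<Rightarrow>
     ('a \<Rightarrow> real) \<Rightarrow> real \<Rightarrow> 'a \<Rightarrow> 'e \<Rightarrow> real \<Rightarrow> real \<Rightarrow> 'a \<Rightarrow> bool"
  for M g1 g2 h \<epsilon> x w where
  accept: "\<lbrakk>proximal_candidate M g1 g2 x w lam x'; rdist M x' x > \<epsilon>;
      sufficient_decrease M (objective g1 g2 h) x lam x'\<rbrakk>
    \<Longrightarrow> adap_rppm_search M g1 g2 h \<epsilon> x w lam lam x'"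
| double: "\<lbrakk>proximal_candidate M g1 g2 x w lam y; rdist M y x > \<epsilon>;
      \<not> sufficient_decrease M (objective g1 g2 h) x lam y;
      adap_rppm_search M g1 g2 h \<epsilon> x w (2 * lam) lam' x'\<rbrakk>
    \<Longrightarrow> adap_rppm_search M g1 g2 h \<epsilon> x w lam lam' x'"

text \<open>\<open>x 1, \<dots>, x N\<close> are the first \<open>N\<close> accepted iterates of a run from \<open>x0\<close> and \<open>lam0\<close>. Here \<open>l k\<close> is
  the parameter on entering iteration \<open>k\<close>, before any doubling there; each accepted parameter is the
  starting one of the next iteration. The values \<open>x k\<close> for \<open>k > N\<close> are unconstrained.\<close>

definition adap_rppm ::
    "('a::topological_space, 'e::euclidean_space) riemannian_structure \<Rightarrow> ('a \<Rightarrow> ereal) \<Rightarrow> ('a \<Rightarrow> real) \<Rightarrow>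
     ('a \<Rightarrow> real) \<Rightarrow> real \<Rightarrow> 'a \<Rightarrow> real \<Rightarrow> nat \<Rightarrow> (nat \<Rightarrow> 'a) \<Rightarrow> bool" where
  "adap_rppm M g1 g2 h \<epsilon> x0 lam0 N x \<longleftrightarrow>
     (\<exists>l. x 0 = x0 \<and> l 0 = lam0 \<and>
        (\<forall>k<N. \<exists>w\<in>subdifferential M h (x k).
           adap_rppm_search M g1 g2 h \<epsilon> (x k) w (l k) (l (Suc k)) (x (Suc k))))"

end

theory Submission
  imports Defs
begin

text \<open>Doubling never decreases the parameter, so each accepted step lowers \<open>f\<close> by more than
  \<open>\<lambda>\<^sub>0 \<epsilon>\<^sup>2 / 4\<close>. As \<open>f\<close> is bounded below, only finitely many steps fit; counting \<open>T + 1\<close> of them makes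
  the bound on \<open>T\<close> strict.\<close>

lemma adap_rppm_search_accepted:
  assumes "adap_rppm_search M g1 g2 h \<epsilon> x w lam lam' x'" and "lam > 0"
  shows "lam \<le> lam'" and "rdist M x' x > \<epsilon>"
    and "sufficient_decrease M (objective g1 g2 h) x lam' x'"
proof -
  \<comment> \<open>Induction over the doublings: every rejected candidate is discarded, and the two
    tests are read off from the final \<open>accept\<close>. Positivity of \<open>lam\<close> passes
    to \<open>2 * lam\<close> and gives \<open>lam \<le> 2 * lam\<close>.\<close>
  have "lam \<le> lam' \<and> rdist M x' x > \<epsilon> \<and> sufficient_decrease M (objective g1 g2 h) x lam' x'"
    using assms by (induction rule: adap_rppm_search.induct) auto
  then show "lam \<le> lam'" "rdist M x' x > \<epsilon>"
    "sufficient_decrease M (objective g1 g2 h) x lam' x'" by auto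
qed

text \<open>Replacing \<open>lam\<close> by \<open>lam0\<close> and the distance by
  \<open>\<epsilon>\<close> makes the guaranteed decrease the same at every iteration. The real
  witness \<open>b\<close> moves the estimate from \<open>ereal\<close> to \<open>real\<close>, so
  that decreases can be summed.\<close>

lemma sufficient_decrease_finite:
  assumes "sufficient_decrease M f x lam x'" and "lam0 \<le> lam" and "lam0 > 0"
    and "\<epsilon> > 0" and "rdist M x' x > \<epsilon>"
    and "f x = ereal a" and "f x' \<ge> ereal flow"
  obtains b where "f x' = ereal b" and "b \<le> a - lam0 * \<epsilon>\<^sup>2 / 4"
proof -
  have dec: "f x' - ereal a \<le> ereal (- (lam / 4) * (rdist M x' x)\<^sup>2)"
    using assms(1,6) by (simp add: sufficient_decrease_def)
  \<comment> \<open>The decrease test excludes the value \<infinity>, the lower bound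
    \<open>flow\<close> excludes -\<infinity>.\<close>
  obtain b where b: "f x' = ereal b"
    using dec assms(7) by (cases "f x'") auto
  have "\<epsilon>\<^sup>2 \<le> (rdist M x' x)\<^sup>2"
    using assms(4,5) by (intro power_mono) auto
  then have "lam0 * \<epsilon>\<^sup>2 \<le> lam * (rdist M x' x)\<^sup>2"
    using assms(2,3) by (intro mult_mono) auto
  then have "b \<le> a - lam0 * \<epsilon>\<^sup>2 / 4"
    using dec b by simp
  with b show thesis by (rule that)
qed

lemma adap_rppm_descent:
  assumes "adap_rppm M g1 g2 h \<epsilon> x0 lam0 N x" and "lam0 > 0" and "\<epsilon> > 0"
    and "\<forall>y. objective g1 g2 h y \<ge> ereal flow" and "objective g1 g2 h x0 = ereal a"
  shows "\<exists>b. objective g1 g2 h (x N) = ereal b \<and> b \<le> a - real N * (lam0 * \<epsilon>\<^sup>2 / 4)"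
proof -
  let ?f = "objective g1 g2 h"
  obtain l where init: "x 0 = x0" "l 0 = lam0"
    and step: "\<And>k. k < N \<Longrightarrow>
      \<exists>w. adap_rppm_search M g1 g2 h \<epsilon> (x k) w (l k) (l (Suc k)) (x (Suc k))"
    using assms(1) unfolding adap_rppm_def by blast
  \<comment> \<open>The invariant carries the parameter bound along with the value:
    \<open>lam0 \<le> l k\<close> supplies the positivity required by the search lemma and keeps the
    decrease per step uniform.\<close>
  have "lam0 \<le> l k \<and> (\<exists>b. ?f (x k) = ereal b \<and> b \<le> a - real k * (lam0 * \<epsilon>\<^sup>2 / 4))"
    if "k \<le> N" for k
    using that
  proof (induction k)
    case 0
    show ?case using init assms(5) by simp
  next
    case (Suc k)
    then obtain b where l: "lam0 \<le> l k" and b: "?f (x k) = ereal b"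
      and le: "b \<le> a - real k * (lam0 * \<epsilon>\<^sup>2 / 4)" by auto
    obtain w where "adap_rppm_search M g1 g2 h \<epsilon> (x k) w (l k) (l (Suc k)) (x (Suc k))"
      using step Suc.prems by (meson Suc_le_lessD)
    moreover have "l k > 0" using l assms(2) by simp
    ultimately have acc: "l k \<le> l (Suc k)" "rdist M (x (Suc k)) (x k) > \<epsilon>"
        "sufficient_decrease M ?f (x k) (l (Suc k)) (x (Suc k))"
      by (rule adap_rppm_search_accepted)+
    have l': "lam0 \<le> l (Suc k)" using l acc(1) by simp
    obtain b' where "?f (x (Suc k)) = ereal b'" and "b' \<le> b - lam0 * \<epsilon>\<^sup>2 / 4"
      using sufficient_decrease_finite[OF acc(3) l' assms(2,3) acc(2) b] assms(4) by blast
    with l' le show ?case by (auto simp: algebra_simps add_divide_distrib)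
  qed
  then show ?thesis by blast
qed

theorem theorem4p3:
  fixes M :: "('a::{t2_space,second_countable_topology}, 'e::euclidean_space) riemannian_structure"
    and g1 :: "'a \<Rightarrow> ereal" and g2 h :: "'a \<Rightarrow> real"
    and L flow \<epsilon> lam0 :: real and x0 :: 'a and x :: "nat \<Rightarrow> 'a" and T :: nat
  assumes "hadamard_manifold M"
    and "proper_function g1" and "lower_semicontinuous g1"
    and "C1_function M g2" and "L > 0" and "lipschitz_gradient M L g2"
    and "geodesically_convex M h"
    and "\<forall>y. \<exists>\<gamma>::real.
           Liminf (filtercomap (\<lambda>x. rdist M x y) at_top) (\<lambda>x. g1 x / ereal (rdist M x y)) > ereal \<gamma>"
    and "\<forall>x. objective g1 g2 h x \<ge> ereal flow"
    and "x0 \<in> effective_domain (objective g1 g2 h)" and "lam0 > 0" and "\<epsilon> > 0"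
    and "adap_rppm M g1 g2 h \<epsilon> x0 lam0 (Suc T) x"
    and "\<forall>k\<le>T. rdist M (x (Suc k)) (x k) > \<epsilon>"
  shows "ereal (real T) < 4 * (objective g1 g2 h x0 - ereal flow) / ereal (lam0 * \<epsilon>\<^sup>2)"
proof -
  let ?f = "objective g1 g2 h"
  \<comment> \<open>Membership in the effective domain bounds the value above, \<open>flow\<close>
    below.\<close>
  obtain a where a: "?f x0 = ereal a"
    using assms(9)[rule_format, of x0] assms(10)
    by (cases "?f x0") (auto simp: effective_domain_def)
  obtain b where b: "?f (x (Suc T)) = ereal b"
    and le: "b \<le> a - real (Suc T) * (lam0 * \<epsilon>\<^sup>2 / 4)"
    using adap_rppm_descent[OF assms(13,11,12,9) a] by blast
  have "flow \<le> b" using assms(9)[rule_format, of "x (Suc T)"] b by simp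
  have pos: "lam0 * \<epsilon>\<^sup>2 > 0" using assms(11,12) by simp
  \<comment> \<open>The \<open>Suc T\<close> decreases give
    \<open>(T + 1) * (lam0 * \<epsilon>\<^sup>2) \<le> 4 * (a - flow)\<close>; dropping one positive
    summand yields the strict inequality, even when \<open>b = flow\<close>.\<close>
  have "real T * (lam0 * \<epsilon>\<^sup>2) < 4 * (a - flow)"
    using \<open>flow \<le> b\<close> le pos by (simp add: algebra_simps add_divide_distrib)
  then have "real T < 4 * (a - flow) / (lam0 * \<epsilon>\<^sup>2)"
    by (subst pos_less_divide_eq[OF pos])
  \<comment> \<open>All values are finite and the divisor is nonzero, so the \<open>ereal\<close>
    quotient is the real one.\<close>
  moreover have "4 * (?f x0 - ereal flow) / ereal (lam0 * \<epsilon>\<^sup>2)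
      = ereal (4 * (a - flow) / (lam0 * \<epsilon>\<^sup>2))"
    using a assms(11,12) by (simp add: numeral_eq_ereal)
  ultimately show ?thesis by simp
qed

end
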